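(* Let $\lambda>0$ and suppose the proposal distribution factorizes as $r(\boldsymbol{X}^{(\text{joint})}):=r(\boldsymbol{X}^{(\text{miss})})\,p(\boldsymbol{X}^{(\text{obs})})$. Let $$u(\boldsymbol{X}^{(\text{joint})},\tau)=\mathbb{E}_{r(\tilde{\boldsymbol{X}}^{(\text{joint})},\tau)}\Big\{-\lambda\nabla_{\tilde{\boldsymbol{X}}^{(\text{miss})}}\mathcal{K}(\boldsymbol{X}^{(\text{joint})},\tilde{\boldsymbol{X}}^{(\text{joint})})+[\nabla_{\tilde{\boldsymbol{X}}^{(\text{miss})}}\log\hat p(\tilde{\boldsymbol{X}}^{(\text{joint})})]^\top\mathcal{K}(\boldsymbol{X}^{(\text{joint})},\tilde{\boldsymbol{X}}^{(\text{joint})})\Big\}$$ be the velocity field associated with $\mathcal{F}_{\text{joint-NER}}:=\mathbb{E}_{r(\boldsymbol{X}^{(\text{joint})})}[\log\hat p(\boldsymbol{X}^{(\text{joint})})]-\lambda\mathbb{H}[r(\boldsymbol{X}^{(\text{joint})})]$, and let $$u(\boldsymbol{X}^{(\text{miss})},\tau)=\mathbb{E}_{r(\tilde{\boldsymbol{X}}^{(\text{miss})},\tau)}\Big\{-\lambda\nabla_{\tilde{\boldsymbol{X}}^{(\text{miss})}}\mathcal{K}(\boldsymbol{X}^{(\text{miss})},\tilde{\boldsymbol{X}}^{(\text{miss})})+[\nabla_{\tilde{\boldsymbol{X}}^{(\text{miss})}}\log\hat p(\tilde{\boldsymbol{X}}^{(\text{miss})}\mid\boldsymbol{X}^{(\text{obs})})]^\top\mathcal{K}(\boldsymbol{X}^{(\text{miss})},\tilde{\boldsymbol{X}}^{(\text{miss})})\Big\}$$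 be the velocity field associated with $\mathcal{F}_{\text{NER}}:=\mathbb{E}_{r(\boldsymbol{X}^{(\text{miss})})}[\log\hat p(\boldsymbol{X}^{(\text{miss})}\mid\boldsymbol{X}^{(\text{obs})})]-\lambda\mathbb{H}[r(\boldsymbol{X}^{(\text{miss})})]$. Then $$u(\boldsymbol{X}^{(\text{joint})},\tau)=u(\boldsymbol{X}^{(\text{miss})},\tau).$$
   Context: $\boldsymbol{X}^{(\text{obs})}$ denotes the observed entries of the data, with distribution $p(\boldsymbol{X}^{(\text{obs})})$, which remain unchanged during imputation; $\boldsymbol{X}^{(\text{miss})}$ denotes the missing entries, with density $r(\boldsymbol{X}^{(\text{miss})},\tau)$ (the proposal distribution) at time $\tau$; $\boldsymbol{X}^{(\text{joint})}=(\boldsymbol{X}^{(\text{miss})},\boldsymbol{X}^{(\text{obs})})$. Tildes denote further copies with the same density; since the observed entries are unchanged, they are common to $\boldsymbol{X}^{(\text{joint})}$ in both functionals. $\hat p(\boldsymbol{X}^{(\text{joint})})$ is a given (estimated) joint density with conditional $\hat p(\boldsymbol{X}^{(\text{miss})}\mid\boldsymbol{X}^{(\text{obs})})$. $\mathbb{H}[q]:=-\int q\log q$. The kernel $\mathcal{K}$ is the radial basis function kernel $\mathcal{K}(\boldsymbol{X},\tilde{\boldsymbol{X}}):=\exp\big(-\frac{\|\boldsymbol{X}-\tilde{\boldsymbol{X}}\|^2}{2h^2}\big)$ with bandwidth $h$. *)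

theory Defs
  imports "HOL-Analysis.Analysis"
begin

text \<open>
  The missing entries form a vector in \<open>'a::euclidean_space\<close>, the observed entries a vector in
  \<open>'b::euclidean_space\<close>, and the joint data is the pair (missing, observed) in \<open>'a \<times> 'b\<close>, whose
  norm is the Euclidean norm of the concatenated vector.  All densities are with respect to
  Lebesgue measure, and a time-dependent density takes its time as second argument.
\<close>

definition prob_density :: "('v::euclidean_space \<Rightarrow> real) \<Rightarrow> bool" where
  "prob_density q \<longleftrightarrow> (\<forall>v. 0 \<le> q v) \<and> has_bochner_integral lborel q 1"

definition expect :: "('v::euclidean_space \<Rightarrow> real) \<Rightarrow> ('v \<Rightarrow> 'w::euclidean_space) \<Rightarrow> 'w" where
  "expect q g = (\<integral>v. g v \<partial>density lborel (\<lambda>v. ennreal (q v)))"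

definition cond_density ::
    "('a::euclidean_space \<times> 'b::euclidean_space \<Rightarrow> real) \<Rightarrow> 'b \<Rightarrow> 'a \<Rightarrow> real" where
  "cond_density p xo xm = p (xm, xo) / (\<integral>y. p (y, xo) \<partial>lborel)"

definition gradient :: "('v::real_inner \<Rightarrow> real) \<Rightarrow> 'v \<Rightarrow> 'v" where
  "gradient f v = (THE D. GDERIV f v :> D)"

definition gradient_miss :: "('a::real_inner \<times> 'b \<Rightarrow> real) \<Rightarrow> 'a \<times> 'b \<Rightarrow> 'a" where
  "gradient_miss f Z = gradient (\<lambda>y. f (y, snd Z)) (fst Z)"

definition rbf_kernel :: "real \<Rightarrow> 'v::real_normed_vector \<Rightarrow> 'v \<Rightarrow> real" where
  "rbf_kernel h v w = exp (- (norm (v - w))\<^sup>2 / (2 * h\<^sup>2))"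

text \<open>
  The kernelised velocity field belonging to the functional
  \<open>E_r [log pc] - lam H[r]\<close> on densities of the missing entries; \<open>pc\<close> will be the conditional
  density given the observed entries.
\<close>

definition velocity_miss ::
    "real \<Rightarrow> real \<Rightarrow> ('a::euclidean_space \<Rightarrow> real \<Rightarrow> real) \<Rightarrow> ('a \<Rightarrow> real) \<Rightarrow> 'a \<Rightarrow> real \<Rightarrow> 'a" where
  "velocity_miss lam h r pc x \<tau> =
     expect (\<lambda>y. r y \<tau>)
       (\<lambda>y. - lam *\<^sub>R gradient (\<lambda>w. rbf_kernel h x w) y
          + rbf_kernel h x y *\<^sub>R gradient (\<lambda>w. ln (pc w)) y)"

text \<open>
  The velocity field of the missing block belonging to \<open>E_r [log p] - lam H[r]\<close> on joint densities.
  The expectation is over a copy \<open>Y\<close> with the joint proposal density.  Since imputation leaves the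
  observed entries unchanged, the copy shares them with \<open>X\<close>: only its missing block \<open>fst Y\<close> is
  fresh, and the kernel and \<open>p\<close> are evaluated at \<open>(fst Y, snd X)\<close>.
\<close>

definition velocity_joint ::
    "real \<Rightarrow> real \<Rightarrow> ('a::euclidean_space \<times> 'b::euclidean_space \<Rightarrow> real \<Rightarrow> real)
      \<Rightarrow> ('a \<times> 'b \<Rightarrow> real) \<Rightarrow> 'a \<times> 'b \<Rightarrow> real \<Rightarrow> 'a" where
  "velocity_joint lam h r p X \<tau> =
     expect (\<lambda>Y. r Y \<tau>)
       (\<lambda>Y. let X' = (fst Y, snd X) in
            - lam *\<^sub>R gradient_miss (\<lambda>Z. rbf_kernel h X Z) X'
            + rbf_kernel h X X' *\<^sub>R gradient_miss (\<lambda>Z. ln (p Z)) X')"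

end

theory Submission
  imports Defs "HOL-Probability.Probability_Measure"
begin

text \<open>
  Given the observed entries, the conditional density differs from the joint one by a positive
  constant, which the gradient of the logarithm does not see.  The two integrands therefore agree
  and depend only on the missing block, so the observed block of the proposal, being a probability
  density, integrates out.
\<close>

text \<open>\<open>gradient\<close> is a definite description, so it suffices that both functions
  satisfy \<open>GDERIV\<close> for the same vectors \<open>D\<close>: subtracting the constant
  gives one direction, adding it back the other. Points of non-differentiability are covered
  too.\<close>

lemma gradient_diff_const: "gradient (\<lambda>w. f w - c) = gradient f"
proof -
  have "GDERIV (\<lambda>w. f w - c) v :> D \<longleftrightarrow> GDERIV f v :> D" for v D
    unfolding gderiv_def
    using has_derivative_add[of "\<lambda>w. f w - c" _ "at v" "\<lambda>_. c" "\<lambda>_. 0"]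
      has_derivative_diff[of f _ "at v" "\<lambda>_. c" "\<lambda>_. 0"]
    by auto
  then show ?thesis
    by (simp add: fun_eq_iff gradient_def)
qed

lemma gradient_ln_divide_const:
  fixes f :: "'v::real_inner \<Rightarrow> real"
  assumes "\<And>w. 0 < f w" and "0 < c"
  shows "gradient (\<lambda>w. ln (f w / c)) = gradient (\<lambda>w. ln (f w))"
proof -
  have "ln (f w / c) = ln (f w) - ln c" for w
    using assms(1)[of w] \<open>0 < c\<close> by (simp add: ln_div)
  then show ?thesis
    by (simp add: gradient_diff_const)
qed

text \<open>A nonnegative function with zero integral vanishes almost everywhere; for a positive one
  this would make the whole space a null set. Used for the normalising constant in
  \<open>cond_density\<close>.\<close>

lemma integral_lborel_pos:
  fixes f :: "'v::euclidean_space \<Rightarrow> real"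
  assumes "integrable lborel f" and pos: "\<And>v. 0 < f v"
  shows "0 < (\<integral>v. f v \<partial>lborel)"
proof -
  have "(\<integral>v. f v \<partial>lborel) \<noteq> 0"
  proof
    assume "(\<integral>v. f v \<partial>lborel) = 0"
    then have "AE v in lborel. f v = 0"
      using assms by (subst (asm) integral_nonneg_eq_0_iff_AE) (auto intro: less_imp_le)
    then have "AE v in (lborel :: 'v measure). False"
      by eventually_elim (metis pos less_irrefl)
    then show False
      by (simp add: AE_iff_null null_sets_def)
  qed
  then show ?thesis
    using pos by (simp add: less_le integral_nonneg)
qed

lemma prob_density_measurable: "prob_density q \<Longrightarrow> q \<in> borel_measurable borel"
  by (auto simp: prob_density_def has_bochner_integral_iff dest: borel_measurable_integrable)

lemma prob_space_prob_density:
  assumes "prob_density q"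
  shows "prob_space (density lborel (\<lambda>v. ennreal (q v)))"
proof (rule prob_spaceI)
  have "(\<integral>\<^sup>+v. ennreal (q v) \<partial>lborel) = 1"
    using assms by (simp add: prob_density_def has_bochner_integral_iff nn_integral_eq_integral)
  then show "emeasure (density lborel (\<lambda>v. ennreal (q v)))
      (space (density lborel (\<lambda>v. ennreal (q v)))) = 1"
    using prob_density_measurable[OF assms] by (simp add: emeasure_density)
qed

lemma density_lborel_prod:
  fixes r :: "'a::euclidean_space \<Rightarrow> real" and q :: "'b::euclidean_space \<Rightarrow> real"
  assumes r: "prob_density r" and q: "prob_density q"
  shows "density lborel (\<lambda>Y. ennreal (r (fst Y) * q (snd Y)))
    = density lborel (\<lambda>v. ennreal (r v)) \<Otimes>\<^sub>M density lborel (\<lambda>v. ennreal (q v))"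
proof -
  interpret Q: prob_space "density lborel (\<lambda>v. ennreal (q v))"
    by (rule prob_space_prob_density[OF q])
  have "density lborel (\<lambda>v. ennreal (r v)) \<Otimes>\<^sub>M density lborel (\<lambda>v. ennreal (q v))
    = density (lborel \<Otimes>\<^sub>M lborel) (\<lambda>(y, z). ennreal (r y) * ennreal (q z))"
    using prob_density_measurable[OF r] prob_density_measurable[OF q]
    by (intro pair_measure_density)
      (auto intro: lborel.sigma_finite_measure_axioms Q.sigma_finite_measure_axioms)
  also have "(\<lambda>(y, z). ennreal (r y) * ennreal (q z)) = (\<lambda>Y. ennreal (r (fst Y) * q (snd Y)))"
    using r q by (auto simp: fun_eq_iff prob_density_def ennreal_mult)
  finally show ?thesis
    by (simp add: lborel_prod)
qed

text \<open>The second factor has mass 1, so the first marginal of the product measure is the first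
  factor. An arbitrary \<open>g\<close> is allowed because nothing guarantees that the score of
  \<open>p_hat\<close> is measurable.\<close>

lemma expect_fst:
  fixes r :: "'a::euclidean_space \<Rightarrow> real" and q :: "'b::euclidean_space \<Rightarrow> real"
    and g :: "'a \<Rightarrow> 'w::euclidean_space"
  assumes r: "prob_density r" and q: "prob_density q"
  shows "expect (\<lambda>Y. r (fst Y) * q (snd Y)) (\<lambda>Y. g (fst Y)) = expect r g"
proof -
  let ?R = "density lborel (\<lambda>v. ennreal (r v))"
  let ?Q = "density lborel (\<lambda>v. ennreal (q v))"
  interpret Q: prob_space ?Q
    by (rule prob_space_prob_density[OF q])
  have "(\<integral>Y. g (fst Y) \<partial>(?R \<Otimes>\<^sub>M ?Q)) = (\<integral>y. g y \<partial>?R)"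
  proof (cases "g \<in> borel_measurable ?R")
    case True
    then have "(\<integral>Y. g (fst Y) \<partial>(?R \<Otimes>\<^sub>M ?Q)) = (\<integral>y. g y \<partial>distr (?R \<Otimes>\<^sub>M ?Q) ?R fst)"
      by (subst integral_distr) auto
    then show ?thesis
      by (simp add: Q.distr_pair_fst)
  next
    case False
    txt \<open>A non-measurable \<open>g\<close> can arise as the score of a non-differentiable density; then both
      integrals take the junk value 0.\<close>
    have "(\<lambda>Y. g (fst Y)) \<notin> borel_measurable (?R \<Otimes>\<^sub>M ?Q)"
    proof
      assume "(\<lambda>Y. g (fst Y)) \<in> borel_measurable (?R \<Otimes>\<^sub>M ?Q)"
      \<comment> \<open>Restricting to a slice, here at the arbitrary point 0, recovers
        \<open>g\<close>.\<close>
      then have "(\<lambda>y. g (fst (y, 0::'b))) \<in> borel_measurable ?R"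
        by (rule measurable_compose[rotated]) simp
      with False show False
        by simp
    qed
    with False show ?thesis
      by (metis borel_measurable_integrable not_integrable_integral_eq)
  qed
  then show ?thesis
    by (simp add: expect_def density_lborel_prod[OF r q])
qed

theorem corollary3p5:
  fixes r_miss :: "'a::euclidean_space \<Rightarrow> real \<Rightarrow> real"
    and p_obs :: "'b::euclidean_space \<Rightarrow> real"
    and r_joint :: "'a \<times> 'b \<Rightarrow> real \<Rightarrow> real"
    and p_hat :: "'a \<times> 'b \<Rightarrow> real"
    and lam h \<tau> :: real and x_miss :: 'a and x_obs :: 'b
  assumes "0 < lam" and "0 < h"
    and "prob_density (\<lambda>y. r_miss y \<tau>)"
    and "prob_density p_obs"
    and "\<And>y z. r_joint (y, z) \<tau> = r_miss y \<tau> * p_obs z"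
    and "prob_density p_hat"
    and "\<And>y. 0 < p_hat (y, x_obs)"
    and "integrable lborel (\<lambda>y. p_hat (y, x_obs))"
  shows "velocity_joint lam h r_joint p_hat (x_miss, x_obs) \<tau>
       = velocity_miss lam h r_miss (cond_density p_hat x_obs) x_miss \<tau>"
proof -
  have r_joint: "(\<lambda>Y. r_joint Y \<tau>) = (\<lambda>Y. r_miss (fst Y) \<tau> * p_obs (snd Y))"
    using assms(5) by (metis prod.collapse)
  \<comment> \<open>The shared observed block cancels in the difference, which leaves the norm of a
    pair with second entry 0.\<close>
  have kernel: "rbf_kernel h (x_miss, x_obs) (y, x_obs) = rbf_kernel h x_miss y" for y
    by (simp add: rbf_kernel_def norm_Pair)
  have score: "gradient (\<lambda>w. ln (cond_density p_hat x_obs w)) = gradient (\<lambda>w. ln (p_hat (w, x_obs)))"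
    unfolding cond_density_def
    by (intro gradient_ln_divide_const integral_lborel_pos assms(7,8))
  show ?thesis
    unfolding velocity_joint_def velocity_miss_def Let_def gradient_miss_def r_joint fst_conv snd_conv
      kernel score
    \<comment> \<open>After the rewriting, the joint integrand is the missing-block integrand
      composed with \<open>fst\<close>.\<close>
    by (rule expect_fst[OF assms(3,4)])
qed

end
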